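(* Let $\alpha\ge\omega$ be an infinite ordinal and let $m$ be a finite cardinal. Then the free algebra $\mathfrak{Fr}_m\mathrm{Gs}_{\alpha}$ has exactly $2^m$ atoms, and each of these atoms is zero-dimensional.
   Context: The signature of cylindric-type algebras of dimension $\alpha$ consists of binary operations $+,\cdot$, unary operations $-$ and $c_i$ ($i\in\alpha$), and constants $0,1,d_{ij}$ ($i,j\in\alpha$). A sequence is a function with domain $\alpha$; an $\alpha$-dimensional unit is a set $V$ of sequences; its base is the smallest set $U$ with $V\subseteq{}^{\alpha}U$. For sequences $f,g$ and $i\in\alpha$, write $f\equiv_i g$ iff $g=f(i/u)$ for some $u$, where $f(i/u)$ agrees with $f$ except that its value at $i$ is $u$. The full algebra over a unit $V$ is $\mathfrak{P}(V)=\langle\mathcal{P}(V),\cup,\cap,\sim,\emptyset,V,C_i,D_{ij}\rangle_{i,j\in\alpha}$ where $D_{ij}=\{f\in V:f(i)=f(j)\}$ and $C_iX=\{f\in V:\exists g\in X\, f\equiv_i g\}$ for $X\subseteq V$. $\mathrm{Gs}_{\alpha}$ is the class of isomorphic copies of subalgebras of algebras $\mathfrak{P}(V)$ where $V=\bigcup_{k\in I}{}^{\alpha}U_k$ for some family of pairwise disjoint non-empty sets $U_k$. For a class $\mathrm{K}$ of algebras of this signature, $\mathfrak{Fr}_m\mathrm{K}$ denotes the free algebra on $m$ free generators of the variety generated by $\mathrm{K}$. An element $a$ is zero-dimensional if $c_ia=a$ for all $i\in\alpha$; an atom is a minimal non-zero element of the Boolean reduct. *)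

theory Defs
  imports Main "HOL-Library.Disjoint_Sets" "HOL-Library.FuncSet" "HOL-Library.Countable_Set"
begin

section \<open>Cylindric-type algebras\<close>

text \<open>The dimension is the index type \<open>'i\<close>; sequences are functions \<open>'i \<Rightarrow> 'u\<close>.\<close>

record ('i, 'a) cta =
  carrier :: "'a set"
  join :: "'a \<Rightarrow> 'a \<Rightarrow> 'a"
  meet :: "'a \<Rightarrow> 'a \<Rightarrow> 'a"
  compl :: "'a \<Rightarrow> 'a"
  bottom :: 'a
  top_el :: 'a
  cyl :: "'i \<Rightarrow> 'a \<Rightarrow> 'a"
  diag :: "'i \<Rightarrow> 'i \<Rightarrow> 'a"

definition algebra :: "('i, 'a) cta \<Rightarrow> bool" where
  "algebra A \<longleftrightarrow>
     (\<forall>x\<in>carrier A. \<forall>y\<in>carrier A. join A x y \<in> carrier A \<and> meet A x y \<in> carrier A) \<and>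
     (\<forall>x\<in>carrier A. compl A x \<in> carrier A \<and> (\<forall>i. cyl A i x \<in> carrier A)) \<and>
     bottom A \<in> carrier A \<and> top_el A \<in> carrier A \<and> (\<forall>i j. diag A i j \<in> carrier A)"

definition hom :: "('i, 'a) cta \<Rightarrow> ('i, 'b) cta \<Rightarrow> ('a \<Rightarrow> 'b) set" where
  "hom A B = {h. h \<in> carrier A \<rightarrow> carrier B \<and>
     (\<forall>x\<in>carrier A. \<forall>y\<in>carrier A.
        h (join A x y) = join B (h x) (h y) \<and> h (meet A x y) = meet B (h x) (h y)) \<and>
     (\<forall>x\<in>carrier A. h (compl A x) = compl B (h x) \<and> (\<forall>i. h (cyl A i x) = cyl B i (h x))) \<and>
     h (bottom A) = bottom B \<and> h (top_el A) = top_el B \<and>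
     (\<forall>i j. h (diag A i j) = diag B i j)}"

definition isomorphic :: "('i, 'a) cta \<Rightarrow> ('i, 'b) cta \<Rightarrow> bool" where
  "isomorphic A B \<longleftrightarrow> (\<exists>h\<in>hom A B. bij_betw h (carrier A) (carrier B))"

definition subalgebra :: "('i, 'a) cta \<Rightarrow> ('i, 'a) cta \<Rightarrow> bool" where
  "subalgebra B A \<longleftrightarrow> algebra B \<and> carrier B \<subseteq> carrier A \<and> (\<lambda>x. x) \<in> hom B A"

definition le :: "('i, 'a) cta \<Rightarrow> 'a \<Rightarrow> 'a \<Rightarrow> bool" where
  "le A x y \<longleftrightarrow> join A x y = y"

definition atoms :: "('i, 'a) cta \<Rightarrow> 'a set" where
  "atoms A = {a \<in> carrier A. a \<noteq> bottom A \<and>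
     (\<forall>b\<in>carrier A. b \<noteq> bottom A \<and> le A b a \<longrightarrow> b = a)}"

definition zero_dimensional :: "('i, 'a) cta \<Rightarrow> 'a \<Rightarrow> bool" where
  "zero_dimensional A a \<longleftrightarrow> (\<forall>i. cyl A i a = a)"


section \<open>Generalized cylindric set algebras\<close>

definition equiv_at :: "'i \<Rightarrow> ('i \<Rightarrow> 'u) \<Rightarrow> ('i \<Rightarrow> 'u) \<Rightarrow> bool" where
  "equiv_at i f g \<longleftrightarrow> (\<exists>u. g = f(i := u))"

definition full_alg :: "('i \<Rightarrow> 'u) set \<Rightarrow> ('i, ('i \<Rightarrow> 'u) set) cta" where
  "full_alg V = \<lparr>carrier = Pow V, join = (\<union>), meet = (\<inter>), compl = (\<lambda>X. V - X),
     bottom = {}, top_el = V,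
     cyl = (\<lambda>i X. {f \<in> V. \<exists>g\<in>X. equiv_at i f g}),
     diag = (\<lambda>i j. {f \<in> V. f i = f j})\<rparr>"

text \<open>A family of pairwise disjoint non-empty sets is injective, so it may be given as
  a set of sets.\<close>

definition gs_unit :: "('i \<Rightarrow> 'u) set \<Rightarrow> bool" where
  "gs_unit V \<longleftrightarrow> (\<exists>\<U>. disjoint \<U> \<and> {} \<notin> \<U> \<and> V = (\<Union>U\<in>\<U>. {f. range f \<subseteq> U}))"

text \<open>\<open>Gs\<close> contains the isomorphic copies living on the type of sets of sequences over \<open>'u\<close>.
  Every algebra of any other type that is isomorphic to a subalgebra of some \<open>full_alg V\<close>
  with base in \<open>'u\<close> is isomorphic to a member of this set.\<close>

definition Gs :: "('i, ('i \<Rightarrow> 'u) set) cta set" where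
  "Gs = {A. algebra A \<and>
     (\<exists>(V :: ('i \<Rightarrow> 'u) set) B. gs_unit V \<and> subalgebra B (full_alg V) \<and> isomorphic A B)}"


section \<open>Varieties and free algebras\<close>

datatype 'i trm =
    Var nat
  | Join "'i trm" "'i trm"
  | Meet "'i trm" "'i trm"
  | Compl "'i trm"
  | Bottom
  | Top
  | Cyl 'i "'i trm"
  | Diag 'i 'i

primrec vars :: "'i trm \<Rightarrow> nat set" where
  "vars (Var n) = {n}"
| "vars (Join s t) = vars s \<union> vars t"
| "vars (Meet s t) = vars s \<union> vars t"
| "vars (Compl t) = vars t"
| "vars Bottom = {}"
| "vars Top = {}"
| "vars (Cyl i t) = vars t"
| "vars (Diag i j) = {}"

primrec interp :: "('i, 'a) cta \<Rightarrow> (nat \<Rightarrow> 'a) \<Rightarrow> 'i trm \<Rightarrow> 'a" where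
  "interp A \<rho> (Var n) = \<rho> n"
| "interp A \<rho> (Join s t) = join A (interp A \<rho> s) (interp A \<rho> t)"
| "interp A \<rho> (Meet s t) = meet A (interp A \<rho> s) (interp A \<rho> t)"
| "interp A \<rho> (Compl t) = compl A (interp A \<rho> t)"
| "interp A \<rho> Bottom = bottom A"
| "interp A \<rho> Top = top_el A"
| "interp A \<rho> (Cyl i t) = cyl A i (interp A \<rho> t)"
| "interp A \<rho> (Diag i j) = diag A i j"

definition satisfies :: "('i, 'a) cta \<Rightarrow> 'i trm \<Rightarrow> 'i trm \<Rightarrow> bool" where
  "satisfies A s t \<longleftrightarrow>
     (\<forall>\<rho>. (\<forall>n. \<rho> n \<in> carrier A) \<longrightarrow> interp A \<rho> s = interp A \<rho> t)"

definition identities :: "('i, 'a) cta set \<Rightarrow> ('i trm \<times> 'i trm) set" where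
  "identities K = {(s, t). \<forall>A\<in>K. satisfies A s t}"

text \<open>A variety is an equationally definable class, so the variety generated by \<open>K\<close> consists
  of the models of all identities valid in \<open>K\<close>. It has members of every type; \<open>variety K\<close> at
  type \<open>('i, 'b) cta set\<close> collects those with elements in \<open>'b\<close>.\<close>

definition variety :: "('i, 'a) cta set \<Rightarrow> ('i, 'b) cta set" where
  "variety K = {A. algebra A \<and> (\<forall>(s, t)\<in>identities K. satisfies A s t)}"

definition term_alg :: "nat \<Rightarrow> ('i, 'i trm) cta" where
  "term_alg m = \<lparr>carrier = {t. vars t \<subseteq> {..<m}}, join = Join, meet = Meet, compl = Compl,
     bottom = Bottom, top_el = Top, cyl = Cyl, diag = Diag\<rparr>"

definition congruence :: "('i, 'a) cta \<Rightarrow> ('a \<times> 'a) set \<Rightarrow> bool" where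
  "congruence A \<theta> \<longleftrightarrow> equiv (carrier A) \<theta> \<and>
     (\<forall>(x, x')\<in>\<theta>. \<forall>(y, y')\<in>\<theta>.
        (join A x y, join A x' y') \<in> \<theta> \<and> (meet A x y, meet A x' y') \<in> \<theta>) \<and>
     (\<forall>(x, x')\<in>\<theta>. (compl A x, compl A x') \<in> \<theta> \<and> (\<forall>i. (cyl A i x, cyl A i x') \<in> \<theta>))"

definition quotient_alg :: "('i, 'a) cta \<Rightarrow> ('a \<times> 'a) set \<Rightarrow> ('i, 'a set) cta" where
  "quotient_alg A \<theta> = \<lparr>carrier = carrier A // \<theta>,
     join = (\<lambda>P Q. \<Union>x\<in>P. \<Union>y\<in>Q. \<theta> `` {join A x y}),
     meet = (\<lambda>P Q. \<Union>x\<in>P. \<Union>y\<in>Q. \<theta> `` {meet A x y}),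
     compl = (\<lambda>P. \<Union>x\<in>P. \<theta> `` {compl A x}),
     bottom = \<theta> `` {bottom A},
     top_el = \<theta> `` {top_el A},
     cyl = (\<lambda>i P. \<Union>x\<in>P. \<theta> `` {cyl A i x}),
     diag = (\<lambda>i j. \<theta> `` {diag A i j})\<rparr>"

text \<open>The free algebra on \<open>m\<close> generators of the variety generated by \<open>K\<close> is the quotient of the
  term algebra over \<open>m\<close> variables by the least congruence whose quotient lies in that variety.\<close>

definition free_congruence :: "nat \<Rightarrow> ('i, 'a) cta set \<Rightarrow> ('i trm \<times> 'i trm) set" where
  "free_congruence m K =
     \<Inter>{\<theta>. congruence (term_alg m) \<theta> \<and> quotient_alg (term_alg m) \<theta> \<in> variety K}"

definition free_alg :: "nat \<Rightarrow> ('i, 'a) cta set \<Rightarrow> ('i, 'i trm set) cta" where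
  "free_alg m K = quotient_alg (term_alg m) (free_congruence m K)"


section \<open>Independence of the type of base elements\<close>

text \<open>\<open>Gs\<close> restricts bases to subsets of the type \<open>'u\<close>. By a Loewenheim-Skolem argument this
  does not affect the generated variety, as long as \<open>'u\<close> is infinite.\<close>

lemma interp_hom:
  assumes "h \<in> hom A B" "algebra A" "\<forall>n. \<rho> n \<in> carrier A"
  shows "interp A \<rho> t \<in> carrier A \<and> h (interp A \<rho> t) = interp B (\<lambda>n. h (\<rho> n)) t"
  using assms by (induction t) (auto simp: hom_def algebra_def)

lemma full_alg_sel:
  "carrier (full_alg V) = Pow V" "join (full_alg V) = (\<union>)" "meet (full_alg V) = (\<inter>)"
  "compl (full_alg V) X = V - X" "bottom (full_alg V) = {}" "top_el (full_alg V) = V"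
  "cyl (full_alg V) i X = {f \<in> V. \<exists>g\<in>X. equiv_at i f g}"
  "diag (full_alg V) i j = {f \<in> V. f i = f j}"
  by (simp_all add: full_alg_def)

lemma algebra_full_alg: "algebra (full_alg V)"
  by (auto simp: algebra_def full_alg_sel)

lemma full_alg_in_Gs:
  assumes "gs_unit V"
  shows "full_alg V \<in> Gs"
proof -
  have id: "(\<lambda>x. x) \<in> hom (full_alg V) (full_alg V)"
    by (auto simp: hom_def)
  have "subalgebra (full_alg V) (full_alg V)"
    using id by (simp add: subalgebra_def algebra_full_alg)
  moreover have "isomorphic (full_alg V) (full_alg V)"
    unfolding isomorphic_def using id by (auto intro!: bexI[OF _ id] simp: bij_betw_def)
  ultimately show ?thesis
    using assms algebra_full_alg unfolding Gs_def by blast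
qed

lemma identities_Gs_iff:
  "(s, t) \<in> identities (Gs :: ('i, ('i \<Rightarrow> 'u) set) cta set) \<longleftrightarrow>
     (\<forall>V :: ('i \<Rightarrow> 'u) set. gs_unit V \<longrightarrow> satisfies (full_alg V) s t)"
proof
  assume "(s, t) \<in> identities (Gs :: ('i, ('i \<Rightarrow> 'u) set) cta set)"
  then show "\<forall>V :: ('i \<Rightarrow> 'u) set. gs_unit V \<longrightarrow> satisfies (full_alg V) s t"
    using full_alg_in_Gs by (auto simp: identities_def)
next
  assume *: "\<forall>V :: ('i \<Rightarrow> 'u) set. gs_unit V \<longrightarrow> satisfies (full_alg V) s t"
  have "satisfies A s t" if A: "A \<in> Gs" for A :: "('i, ('i \<Rightarrow> 'u) set) cta"
    unfolding satisfies_def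
  proof (intro allI impI)
    fix \<rho> :: "nat \<Rightarrow> ('i \<Rightarrow> 'u) set" assume \<rho>: "\<forall>n. \<rho> n \<in> carrier A"
    from A obtain V :: "('i \<Rightarrow> 'u) set" and B h where V: "gs_unit V" and B: "subalgebra B (full_alg V)"
      and h: "h \<in> hom A B" and bij: "bij_betw h (carrier A) (carrier B)" and alg: "algebra A"
      by (auto simp: Gs_def isomorphic_def)
    have \<rho>h: "\<forall>n. h (\<rho> n) \<in> carrier B"
      using \<rho> h by (auto simp: hom_def)
    have e: "h (interp A \<rho> r) = interp (full_alg V) (\<lambda>n. h (\<rho> n)) r" for r
    proof -
      have "h (interp A \<rho> r) = interp B (\<lambda>n. h (\<rho> n)) r"
        using interp_hom[OF h alg \<rho>] by blast
      also have "\<dots> = interp (full_alg V) (\<lambda>n. h (\<rho> n)) r"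
        using interp_hom[of "\<lambda>x. x" B "full_alg V" "\<lambda>n. h (\<rho> n)" r] B \<rho>h
        by (simp add: subalgebra_def)
      finally show ?thesis .
    qed
    have "interp (full_alg V) (\<lambda>n. h (\<rho> n)) s = interp (full_alg V) (\<lambda>n. h (\<rho> n)) t"
    proof -
      have "\<forall>n. h (\<rho> n) \<in> carrier (full_alg V)"
        using \<rho>h B by (auto simp: subalgebra_def)
      then show ?thesis
        using * V by (simp add: satisfies_def)
    qed
    then have "h (interp A \<rho> s) = h (interp A \<rho> t)"
      using e by metis
    then show "interp A \<rho> s = interp A \<rho> t"
      using bij interp_hom[OF h alg \<rho>] by (metis bij_betw_imp_inj_on inj_onD)
  qed
  then show "(s, t) \<in> identities (Gs :: ('i, ('i \<Rightarrow> 'u) set) cta set)"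
    by (auto simp: identities_def)
qed

primrec inds :: "'i trm \<Rightarrow> 'i set" where
  "inds (Var n) = {}"
| "inds (Join s t) = inds s \<union> inds t"
| "inds (Meet s t) = inds s \<union> inds t"
| "inds (Compl t) = inds t"
| "inds Bottom = {}"
| "inds Top = {}"
| "inds (Cyl i t) = insert i (inds t)"
| "inds (Diag i j) = {i, j}"

primrec subterms :: "'i trm \<Rightarrow> 'i trm set" where
  "subterms (Var n) = {Var n}"
| "subterms (Join s t) = insert (Join s t) (subterms s \<union> subterms t)"
| "subterms (Meet s t) = insert (Meet s t) (subterms s \<union> subterms t)"
| "subterms (Compl t) = insert (Compl t) (subterms t)"
| "subterms Bottom = {Bottom}"
| "subterms Top = {Top}"
| "subterms (Cyl i t) = insert (Cyl i t) (subterms t)"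
| "subterms (Diag i j) = {Diag i j}"

lemma finite_inds: "finite (inds t)"
  by (induction t) auto

lemma finite_subterms: "finite (subterms t)"
  by (induction t) auto

lemma subterms_refl: "t \<in> subterms t"
  by (cases t) auto

definition variants :: "'i set \<Rightarrow> ('i \<Rightarrow> 'v) \<Rightarrow> 'v set \<Rightarrow> ('i \<Rightarrow> 'v) set" where
  "variants \<Gamma> f S = {g. (\<forall>i\<in>\<Gamma>. g i \<in> S) \<and> (\<forall>i. i \<notin> \<Gamma> \<longrightarrow> g i = f i)}"

lemma finite_variants:
  assumes "finite \<Gamma>" "finite S"
  shows "finite (variants \<Gamma> f S)"
proof (rule finite_subset)
  show "variants \<Gamma> f S \<subseteq> (\<lambda>g i. if i \<in> \<Gamma> then g i else f i) ` (PiE \<Gamma> (\<lambda>_. S))"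
  proof
    fix g assume g: "g \<in> variants \<Gamma> f S"
    have "g = (\<lambda>i. if i \<in> \<Gamma> then restrict g \<Gamma> i else f i)"
      using g by (auto simp: variants_def)
    moreover have "restrict g \<Gamma> \<in> PiE \<Gamma> (\<lambda>_. S)"
      using g by (auto simp: variants_def)
    ultimately show "g \<in> (\<lambda>g i. if i \<in> \<Gamma> then g i else f i) ` (PiE \<Gamma> (\<lambda>_. S))"
      by (rule image_eqI)
  qed
  show "finite ((\<lambda>g i. if i \<in> \<Gamma> then g i else f i) ` (PiE \<Gamma> (\<lambda>_. S)))"
    using assms by (intro finite_imageI finite_PiE) auto
qed

lemma countable_witnesses:
  fixes f :: "'i \<Rightarrow> 'v"
  assumes fin: "finite \<Gamma>" "finite \<X>"
  obtains T where "countable T" "f ` \<Gamma> \<subseteq> T"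
    "\<And>g i X. g \<in> variants \<Gamma> f T \<Longrightarrow> i \<in> \<Gamma> \<Longrightarrow> X \<in> \<X> \<Longrightarrow> \<exists>u. g(i := u) \<in> X \<Longrightarrow> \<exists>u\<in>T. g(i := u) \<in> X"
proof -
  define w where "w = (\<lambda>(g :: 'i \<Rightarrow> 'v, i, X). SOME u :: 'v. g(i := u) \<in> X)"
  define S where "S = rec_nat (f ` \<Gamma>) (\<lambda>_ S. S \<union> w ` (variants \<Gamma> f S \<times> \<Gamma> \<times> \<X>))"
  have S0: "S 0 = f ` \<Gamma>" and SS: "\<And>n. S (Suc n) = S n \<union> w ` (variants \<Gamma> f (S n) \<times> \<Gamma> \<times> \<X>)"
    by (simp_all add: S_def)
  have finS: "finite (S n)" for n
    by (induction n) (auto simp: S0 SS fin finite_variants)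
  have mono: "S k \<subseteq> S n" if "k \<le> n" for k n
    using that by (rule lift_Suc_mono_le[rotated]) (auto simp: SS)
  show thesis
  proof
    show "countable (\<Union>n. S n)"
      using finS by (auto intro: countable_finite)
    show "f ` \<Gamma> \<subseteq> (\<Union>n. S n)"
      using S0 by blast
    fix g i X
    assume g: "g \<in> variants \<Gamma> f (\<Union>n. S n)" and i: "i \<in> \<Gamma>" and X: "X \<in> \<X>"
      and ex: "\<exists>u. g(i := u) \<in> X"
    from g have "\<forall>j\<in>\<Gamma>. \<exists>n. g j \<in> S n"
      by (auto simp: variants_def)
    then obtain N where N: "\<forall>j\<in>\<Gamma>. g j \<in> S (N j)"
      by metis
    define n where "n = Max (N ` \<Gamma>)"
    have "g j \<in> S n" if "j \<in> \<Gamma>" for j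
      using N that mono[of "N j" n] fin(1) by (auto simp: n_def)
    then have "g \<in> variants \<Gamma> f (S n)"
      using g by (auto simp: variants_def)
    then have "w (g, i, X) \<in> S (Suc n)"
      using i X by (auto simp: SS)
    moreover have "g(i := w (g, i, X)) \<in> X"
      unfolding w_def using someI_ex[OF ex] by simp
    ultimately show "\<exists>u\<in>(\<Union>n. S n). g(i := u) \<in> X"
      by blast
  qed
qed

lemma countable_inj_into_infinite:
  assumes "countable T" "infinite (UNIV :: 'u set)"
  obtains e :: "'v \<Rightarrow> 'u" where "inj_on e T"
proof -
  obtain a :: "nat \<Rightarrow> 'u" where "inj a"
    using assms(2) infinite_countable_subset by blast
  moreover obtain b :: "'v \<Rightarrow> nat" where "inj_on b T"
    using assms(1) by (auto simp: countable_def)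
  ultimately have "inj_on (a \<circ> b) T"
    by (auto intro!: comp_inj_on intro: inj_on_subset)
  then show thesis
    by (rule that)
qed

lemma interp_full_alg_subset:
  assumes "\<forall>n. \<rho> n \<subseteq> V"
  shows "interp (full_alg V) \<rho> t \<subseteq> V"
  using assms by (induction t) (auto simp: full_alg_sel)

lemma shrink_base:
  fixes V :: "('i \<Rightarrow> 'v) set" and f :: "'i \<Rightarrow> 'v"
  assumes V: "gs_unit V" and \<rho>: "\<forall>n. \<rho> n \<subseteq> V" and f: "f \<in> V"
    and fin: "finite R"
    and infi: "infinite (UNIV :: 'i set)" and infu: "infinite (UNIV :: 'u set)"
  obtains V' :: "('i \<Rightarrow> 'u) set" and \<rho>' f' where "gs_unit V'" "\<forall>n. \<rho>' n \<subseteq> V'" "f' \<in> V'"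
    "\<forall>r\<in>R. f' \<in> interp (full_alg V') \<rho>' r \<longleftrightarrow> f \<in> interp (full_alg V) \<rho> r"
proof -
  obtain \<U> where disj: "disjoint \<U>" and VU: "V = (\<Union>U\<in>\<U>. {f. range f \<subseteq> U})"
    using V by (auto simp: gs_unit_def)
  obtain U where U: "U \<in> \<U>" and fU: "range f \<subseteq> U"
    using f VU by auto
  define i0 :: 'i where "i0 = undefined"
  define \<Gamma> where "\<Gamma> = insert i0 (\<Union>r\<in>R. inds r)"
  have fin\<Gamma>: "finite \<Gamma>"
    using fin by (auto simp: \<Gamma>_def finite_inds)
  define \<X> where "\<X> = interp (full_alg V) \<rho> ` (\<Union>r\<in>R. subterms r)"
  have fin\<X>: "finite \<X>"
    using fin by (auto simp: \<X>_def finite_subterms)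
  obtain T0 where T0: "countable T0" "f ` \<Gamma> \<subseteq> T0"
    and wit: "\<And>g i X. g \<in> variants \<Gamma> f T0 \<Longrightarrow> i \<in> \<Gamma> \<Longrightarrow> X \<in> \<X> \<Longrightarrow> \<exists>u. g(i := u) \<in> X
        \<Longrightarrow> \<exists>u\<in>T0. g(i := u) \<in> X"
    by (rule countable_witnesses[OF fin\<Gamma> fin\<X>, of f]) blast
  define T where "T = T0 \<inter> U"
  have stay: "u \<in> U" if g: "range g \<subseteq> U" and h: "g(i := u) \<in> V" for g i u
  proof -
    obtain U2 where U2: "U2 \<in> \<U>" and r: "range (g(i := u)) \<subseteq> U2"
      using h VU by auto
    obtain j where "j \<noteq> i"
      using infi by (metis ex_new_if_finite finite.emptyI finite_insert singletonI)
    then have "g j \<in> U \<inter> U2"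
      using g r by (metis IntI fun_upd_other rangeI subsetD)
    then have "U = U2"
      using disj U U2 by (auto simp: disjoint_def)
    then show ?thesis
      using r by (metis fun_upd_same rangeI subsetD)
  qed
  have varU: "range g \<subseteq> U" if "g \<in> variants \<Gamma> f T" for g
  proof (clarify)
    fix j show "g j \<in> U"
      using that fU by (cases "j \<in> \<Gamma>") (auto simp: variants_def T_def)
  qed
  have varV: "g \<in> V" if "g \<in> variants \<Gamma> f T" for g
    using varU[OF that] U VU by auto
  have witT: "\<exists>u\<in>T. g(i := u) \<in> X"
    if g: "g \<in> variants \<Gamma> f T" and iX: "i \<in> \<Gamma>" "X \<in> \<X>" "\<exists>u. g(i := u) \<in> X" for g i X
  proof -
    have "g \<in> variants \<Gamma> f T0"
      using g by (auto simp: variants_def T_def)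
    then obtain u where u: "u \<in> T0" "g(i := u) \<in> X"
      using wit[OF _ iX] by blast
    moreover have "X \<subseteq> V"
      using iX(2) interp_full_alg_subset[OF \<rho>] by (auto simp: \<X>_def)
    ultimately show ?thesis
      using stay[OF varU[OF g], of i u] by (auto simp: T_def)
  qed
  have "countable T"
    using T0(1) by (simp add: T_def)
  then obtain e :: "'v \<Rightarrow> 'u" where e: "inj_on e T"
    using countable_inj_into_infinite infu by blast
  have fT: "f j \<in> T" if "j \<in> \<Gamma>" for j
    using T0(2) fU that by (auto simp: T_def)
  have i0: "i0 \<in> \<Gamma>"
    by (simp add: \<Gamma>_def)
  define V' where "V' = {h :: 'i \<Rightarrow> 'u. range h \<subseteq> e ` T}"
  define p where "p = (\<lambda>h j. if j \<in> \<Gamma> then inv_into T e (h j) else f j)"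
  define \<rho>' where "\<rho>' = (\<lambda>n. {h \<in> V'. p h \<in> \<rho> n})"
  define f' where "f' = (\<lambda>j. e (if j \<in> \<Gamma> then f j else f i0))"
  have pv: "p h \<in> variants \<Gamma> f T" if "h \<in> V'" for h
    using that by (auto simp: p_def variants_def V'_def intro!: inv_into_into)
  have pupd: "p (h(i := e u)) = (p h)(i := u)" if "i \<in> \<Gamma>" "u \<in> T" for h i u
    using that e by (auto simp: p_def fun_eq_iff)
  have key: "h \<in> interp (full_alg V') \<rho>' r \<longleftrightarrow> p h \<in> interp (full_alg V) \<rho> r"
    if "h \<in> V'" "inds r \<subseteq> \<Gamma>" "interp (full_alg V) \<rho> ` subterms r \<subseteq> \<X>" for h r
    using that
  proof (induction r arbitrary: h)
    case (Var n)
    then show ?case by (simp add: \<rho>'_def)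
  next
    case (Join r1 r2)
    then show ?case by (simp add: full_alg_sel image_Un)
  next
    case (Meet r1 r2)
    then show ?case by (simp add: full_alg_sel image_Un)
  next
    case (Compl r)
    then show ?case using varV[OF pv] by (simp add: full_alg_sel)
  next
    case Bottom
    then show ?case by (simp add: full_alg_sel)
  next
    case Top
    then show ?case using varV[OF pv] by (simp add: full_alg_sel)
  next
    case (Diag i j)
    have hj: "h k \<in> e ` T" for k
      using Diag(1) by (auto simp: V'_def)
    have "h i = h j \<longleftrightarrow> inv_into T e (h i) = inv_into T e (h j)"
      using hj by (metis f_inv_into_f)
    then show ?case
      using Diag varV[OF pv] by (simp add: full_alg_sel p_def)
  next
    case (Cyl i r)
    let ?I = "interp (full_alg V) \<rho> r" and ?I' = "interp (full_alg V') \<rho>' r"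
    have i: "i \<in> \<Gamma>" and X: "?I \<in> \<X>"
      using Cyl.prems subterms_refl[of r] by auto
    have IH: "h' \<in> ?I' \<longleftrightarrow> p h' \<in> ?I" if "h' \<in> V'" for h'
      using Cyl that by auto
    have I'V: "?I' \<subseteq> V'"
      by (rule interp_full_alg_subset) (auto simp: \<rho>'_def)
    have "(\<exists>u. h(i := u) \<in> ?I') \<longleftrightarrow> (\<exists>u\<in>T. h(i := e u) \<in> ?I')"
    proof
      assume "\<exists>u. h(i := u) \<in> ?I'"
      then obtain u where u: "h(i := u) \<in> ?I'" by blast
      then have "range (h(i := u)) \<subseteq> e ` T"
        using I'V unfolding V'_def by blast
      then have "u \<in> e ` T"
        by (metis fun_upd_same rangeI subsetD)
      then show "\<exists>u\<in>T. h(i := e u) \<in> ?I'"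
        using u by auto
    qed auto
    also have "\<dots> \<longleftrightarrow> (\<exists>u\<in>T. (p h)(i := u) \<in> ?I)"
    proof (rule bex_cong[OF refl])
      fix u assume u: "u \<in> T"
      have "h(i := e u) \<in> V'"
        using u Cyl.prems(1) by (auto simp: V'_def)
      then show "h(i := e u) \<in> ?I' \<longleftrightarrow> (p h)(i := u) \<in> ?I"
        using IH pupd[OF i u] by simp
    qed
    also have "\<dots> \<longleftrightarrow> (\<exists>u. (p h)(i := u) \<in> ?I)"
      using witT[OF pv[OF Cyl.prems(1)] i X] by blast
    finally show ?case
      using Cyl.prems(1) varV[OF pv[OF Cyl.prems(1)]]
      by (auto simp: full_alg_sel equiv_at_def)
  qed
  have f'V: "f' \<in> V'"
    using fT i0 by (auto simp: f'_def V'_def)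
  have pf: "p f' = f"
    using fT e by (auto simp: p_def f'_def fun_eq_iff)
  show thesis
  proof
    show "gs_unit V'"
      unfolding gs_unit_def using fT[OF i0]
      by (intro exI[of _ "{e ` T}"]) (auto simp: V'_def disjoint_def)
    show "\<forall>n. \<rho>' n \<subseteq> V'"
      by (auto simp: \<rho>'_def)
    show "f' \<in> V'" by (rule f'V)
    show "\<forall>r\<in>R. f' \<in> interp (full_alg V') \<rho>' r \<longleftrightarrow> f \<in> interp (full_alg V) \<rho> r"
    proof
      fix r assume "r \<in> R"
      then show "f' \<in> interp (full_alg V') \<rho>' r \<longleftrightarrow> f \<in> interp (full_alg V) \<rho> r"
        using key[OF f'V, of r] pf by (auto simp: \<Gamma>_def \<X>_def)
    qed
  qed
qed

lemma identities_Gs_subset: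
  assumes "infinite (UNIV :: 'i set)" "infinite (UNIV :: 'u set)"
  shows "identities (Gs :: ('i, ('i \<Rightarrow> 'u) set) cta set) \<subseteq>
    identities (Gs :: ('i, ('i \<Rightarrow> 'v) set) cta set)"
proof clarify
  fix s t assume st: "(s, t) \<in> identities (Gs :: ('i, ('i \<Rightarrow> 'u) set) cta set)"
  have eq: "f \<in> interp (full_alg V) \<rho> s \<longleftrightarrow> f \<in> interp (full_alg V) \<rho> t"
    if V: "gs_unit V" and \<rho>: "\<forall>n. \<rho> n \<subseteq> V" and f: "f \<in> V"
    for V :: "('i \<Rightarrow> 'v) set" and \<rho> f
  proof -
    have finite_st: "finite {s, t}" by simp
    obtain V' :: "('i \<Rightarrow> 'u) set" and \<rho>' f' where *: "gs_unit V'" "\<forall>n. \<rho>' n \<subseteq> V'"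
      "f' \<in> V'" "\<forall>r\<in>{s, t}. f' \<in> interp (full_alg V') \<rho>' r \<longleftrightarrow> f \<in> interp (full_alg V) \<rho> r"
      by (rule shrink_base[OF V \<rho> f finite_st assms]) (rule that)
    have "interp (full_alg V') \<rho>' s = interp (full_alg V') \<rho>' t"
      using st *(1,2) by (simp add: identities_Gs_iff satisfies_def full_alg_sel)
    then show ?thesis
      using *(4) by auto
  qed
  have "interp (full_alg V) \<rho> s = interp (full_alg V) \<rho> t"
    if "gs_unit V" "\<forall>n. \<rho> n \<subseteq> V" for V :: "('i \<Rightarrow> 'v) set" and \<rho>
  proof (intro equalityI subsetI)
    fix f assume f: "f \<in> interp (full_alg V) \<rho> s"
    then show "f \<in> interp (full_alg V) \<rho> t"
      using eq[OF that] interp_full_alg_subset[OF that(2)] by blast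
  next
    fix f assume f: "f \<in> interp (full_alg V) \<rho> t"
    then show "f \<in> interp (full_alg V) \<rho> s"
      using eq[OF that] interp_full_alg_subset[OF that(2)] by blast
  qed
  then show "(s, t) \<in> identities (Gs :: ('i, ('i \<Rightarrow> 'v) set) cta set)"
    by (simp add: identities_Gs_iff satisfies_def full_alg_sel)
qed

theorem identities_Gs_base_type:
  assumes "infinite (UNIV :: 'i set)" "infinite (UNIV :: 'u set)" "infinite (UNIV :: 'v set)"
  shows "identities (Gs :: ('i, ('i \<Rightarrow> 'u) set) cta set) =
    identities (Gs :: ('i, ('i \<Rightarrow> 'v) set) cta set)"
  by (intro equalityI identities_Gs_subset assms)

end

theory Submission
  imports Defs
begin

text \<open>Two terms represent the same element of the free algebra iff they agree at every sequence of
  every full algebra over a single Cartesian space. The term \<open>\<delta> = -c\<^sub>i c\<^sub>j -d\<^sub>i\<^sub>j\<close> with \<open>i \<noteq> j\<close>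
  says that the base is a singleton. Over a singleton base each generator is empty or everything,
  and its choice decides every term; so \<open>\<delta>\<close> is the sum of \<open>2^m\<close> atoms. There are no atoms below
  \<open>-\<delta>\<close>: a term \<open>t\<close> mentions only finitely many indices, so if it holds at \<open>f\<close>, then it also holds,
  under another valuation, at every sequence agreeing with \<open>f\<close> on these indices. Hence, if the base
  has two elements, a diagonal element with two fresh indices splits \<open>t\<close>.\<close>

section \<open>The free algebra as terms modulo identities\<close>

lemma congruence_class_eq_iff:
  assumes "congruence A \<theta>" and "x \<in> carrier A" "y \<in> carrier A"
  shows "\<theta> `` {x} = \<theta> `` {y} \<longleftrightarrow> (x, y) \<in> \<theta>"
  using assms eq_equiv_class_iff by (fastforce simp: congruence_def)

text \<open>The operations of \<open>quotient_alg\<close> are unions over all representatives;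
  compatibility with \<open>\<theta>\<close> makes all classes in such a union equal, so it
  collapses to the class of a single result.\<close>

lemma quotient_map_hom:
  assumes cong: "congruence A \<theta>"
  shows "(\<lambda>x. \<theta> `` {x}) \<in> hom A (quotient_alg A \<theta>)"
proof -
  have eqv: "equiv (carrier A) \<theta>"
    using cong by (simp add: congruence_def)
  have 1: "(\<Union>x\<in>\<theta> `` {a}. \<theta> `` {f x}) = \<theta> `` {f a}"
    if "a \<in> carrier A" "\<forall>(x, x')\<in>\<theta>. (f x, f x') \<in> \<theta>" for f a
    by (rule UN_equiv_class[OF eqv _ that(1)])
       (use that(2) in \<open>auto simp: congruent_def intro!: equiv_class_eq[OF eqv]\<close>)
  have 2: "(\<Union>x\<in>\<theta> `` {a}. \<Union>y\<in>\<theta> `` {b}. \<theta> `` {f x y}) = \<theta> `` {f a b}"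
    if "a \<in> carrier A" "b \<in> carrier A"
      "\<forall>(x, x')\<in>\<theta>. \<forall>(y, y')\<in>\<theta>. (f x y, f x' y') \<in> \<theta>" for f a b
    by (rule UN_equiv_class2[OF eqv eqv _ that(1,2)])
       (use that(3) in \<open>auto simp: congruent2_def intro!: equiv_class_eq[OF eqv]\<close>)
  show ?thesis
    unfolding hom_def quotient_alg_def cta.simps mem_Collect_eq
  proof (intro conjI ballI allI funcsetI)
    fix x assume x: "x \<in> carrier A"
    then show "\<theta> `` {x} \<in> carrier A // \<theta>"
      by (rule quotientI)
    show "\<theta> `` {compl A x} = (\<Union>x\<in>\<theta> `` {x}. \<theta> `` {compl A x})"
      by (rule 1[OF x, symmetric]) (use cong in \<open>auto simp: congruence_def\<close>)
    show "\<theta> `` {cyl A i x} = (\<Union>x\<in>\<theta> `` {x}. \<theta> `` {cyl A i x})" for i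
      by (rule 1[OF x, symmetric]) (use cong in \<open>auto simp: congruence_def\<close>)
    fix y assume y: "y \<in> carrier A"
    show "\<theta> `` {join A x y} = (\<Union>x\<in>\<theta> `` {x}. \<Union>y\<in>\<theta> `` {y}. \<theta> `` {join A x y})"
      by (rule 2[OF x y, symmetric]) (use cong in \<open>auto simp: congruence_def\<close>)
    show "\<theta> `` {meet A x y} = (\<Union>x\<in>\<theta> `` {x}. \<Union>y\<in>\<theta> `` {y}. \<theta> `` {meet A x y})"
      by (rule 2[OF x y, symmetric]) (use cong in \<open>auto simp: congruence_def\<close>)
  qed auto
qed

lemma carrier_quotient_alg: "carrier (quotient_alg A \<theta>) = (\<lambda>x. \<theta> `` {x}) ` carrier A"
  by (auto simp: quotient_alg_def quotient_def)

lemma algebra_hom_image: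
  assumes A: "algebra A" and h: "h \<in> hom A B" and surj: "carrier B = h ` carrier A"
  shows "algebra B"
proof -
  have "join B (h x) (h y) = h (join A x y)" "meet B (h x) (h y) = h (meet A x y)"
    "compl B (h x) = h (compl A x)" "cyl B i (h x) = h (cyl A i x)"
    "bottom B = h (bottom A)" "top_el B = h (top_el A)" "diag B i j = h (diag A i j)"
    if "x \<in> carrier A" "y \<in> carrier A" for x y i j
    using h that by (auto simp: hom_def)
  moreover have "bottom A \<in> carrier A"
    using A by (simp add: algebra_def)
  ultimately show ?thesis
    using A unfolding algebra_def surj by auto
qed

section \<open>Terms, substitution and the congruence of valid identities\<close>

lemma algebra_term_alg: "algebra (term_alg m)"
  by (auto simp: algebra_def term_alg_def)

text \<open>Evaluation in the term algebra is simultaneous substitution, so this is the substitution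
  lemma.\<close>

lemma interp_term_alg:
  "interp A \<rho> (interp (term_alg m) \<sigma> t) = interp A (\<lambda>n. interp A \<rho> (\<sigma> n)) t"
  by (induction t) (auto simp: term_alg_def)

lemma interp_closed:
  assumes "algebra A" and "\<forall>n. \<rho> n \<in> carrier A"
  shows "interp A \<rho> t \<in> carrier A"
  using assms by (induction t) (auto simp: algebra_def)

lemma interp_cong_vars:
  assumes "\<forall>n\<in>vars t. \<rho> n = \<rho>' n"
  shows "interp A \<rho> t = interp A \<rho>' t"
  using assms by (induction t) auto

lemma interp_term_alg_Var: "interp (term_alg m) Var t = t"
  by (induction t) (auto simp: term_alg_def)

text \<open>The common kernel of all evaluations of terms in members of \<open>K\<close>. It serves
  as an explicit description of \<open>free_congruence\<close>.\<close>

definition equational_congruence :: "nat \<Rightarrow> ('i, 'a) cta set \<Rightarrow> ('i trm \<times> 'i trm) set" where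
  "equational_congruence m K =
     {(s, t). vars s \<subseteq> {..<m} \<and> vars t \<subseteq> {..<m} \<and> (s, t) \<in> identities K}"

lemma congruence_equational: "congruence (term_alg m) (equational_congruence m K)"
proof -
  have "equiv (carrier (term_alg m)) (equational_congruence m K)"
    by (rule equivI)
       (auto simp: equational_congruence_def term_alg_def identities_def satisfies_def
         refl_on_def sym_def trans_def)
  then show ?thesis
    by (auto simp: congruence_def equational_congruence_def term_alg_def identities_def
        satisfies_def)
qed

text \<open>Choosing representatives turns a valuation in the quotient into a substitution, and
  valid identities are preserved by substitution: a substitution followed by a valuation in a member
  of \<open>K\<close> is again such a valuation.\<close>

lemma quotient_equational_in_variety:
  assumes K: "\<forall>A\<in>K. algebra A"
  shows "quotient_alg (term_alg m) (equational_congruence m K) \<in> variety K"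
proof -
  let ?T = "term_alg m :: ('a, 'a trm) cta"
  let ?\<theta> = "equational_congruence m K"
  let ?Q = "quotient_alg ?T ?\<theta>"
  note hom = quotient_map_hom[OF congruence_equational[of m K]]
  have "algebra ?Q"
    by (rule algebra_hom_image[OF algebra_term_alg hom carrier_quotient_alg])
  moreover have "satisfies ?Q s t" if st: "(s, t) \<in> identities K" for s t
    unfolding satisfies_def
  proof (intro allI impI)
    fix \<rho> :: "nat \<Rightarrow> 'a trm set" assume "\<forall>n. \<rho> n \<in> carrier ?Q"
    then have "\<forall>n. \<exists>x\<in>carrier ?T. \<rho> n = ?\<theta> `` {x}"
      by (auto simp: carrier_quotient_alg)
    then obtain \<sigma> :: "nat \<Rightarrow> 'a trm" where
      \<sigma>: "\<forall>n. \<sigma> n \<in> carrier ?T" "\<rho> = (\<lambda>n. ?\<theta> `` {\<sigma> n})"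
      by metis
    have "interp A \<tau> (interp ?T \<sigma> s) = interp A \<tau> (interp ?T \<sigma> t)"
      if A: "A \<in> K" and \<tau>: "\<forall>n. \<tau> n \<in> carrier A" for A \<tau>
    proof -
      have "\<forall>n. interp A \<tau> (\<sigma> n) \<in> carrier A"
        using interp_closed K A \<tau> by blast
      then show ?thesis
        using st A by (simp add: interp_term_alg identities_def satisfies_def)
    qed
    then have "(interp ?T \<sigma> s, interp ?T \<sigma> t) \<in> identities K"
      by (auto simp: identities_def satisfies_def)
    moreover have closed: "interp ?T \<sigma> r \<in> carrier ?T" for r
      using interp_closed[OF algebra_term_alg \<sigma>(1)] .
    ultimately have "(interp ?T \<sigma> s, interp ?T \<sigma> t) \<in> ?\<theta>"
      by (auto simp: equational_congruence_def term_alg_def)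
    then have "?\<theta> `` {interp ?T \<sigma> s} = ?\<theta> `` {interp ?T \<sigma> t}"
      using congruence_class_eq_iff[OF congruence_equational closed closed] by blast
    then show "interp ?Q \<rho> s = interp ?Q \<rho> t"
      using interp_hom[OF hom algebra_term_alg \<sigma>(1)] by (simp add: \<sigma>(2))
  qed
  ultimately show ?thesis
    by (auto simp: variety_def)
qed

text \<open>The quotient satisfies every identity of \<open>K\<close>; evaluating one at the classes
  of the variables puts the pair itself into \<open>\<theta>\<close>.\<close>

lemma equational_congruence_subset:
  assumes cong: "congruence (term_alg m) \<theta>" and var: "quotient_alg (term_alg m) \<theta> \<in> variety K"
  shows "equational_congruence m K \<subseteq> \<theta>"
proof clarify
  fix s t :: "'a trm" assume "(s, t) \<in> equational_congruence m K"
  then have st: "vars s \<subseteq> {..<m}" "vars t \<subseteq> {..<m}" "(s, t) \<in> identities K"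
    by (auto simp: equational_congruence_def)
  let ?T = "term_alg m :: ('a, 'a trm) cta"
  let ?Q = "quotient_alg ?T \<theta>"
  note hom = quotient_map_hom[OF cong]
  \<comment> \<open>A valuation must cover all variables. Those from \<open>m\<close> on lie outside
    the carrier and get the default \<open>Bottom\<close>; they do not occur in \<open>s\<close> and
    \<open>t\<close>.\<close>
  define \<sigma> :: "nat \<Rightarrow> 'a trm" where "\<sigma> = (\<lambda>n. if n < m then Var n else Bottom)"
  have \<sigma>: "\<forall>n. \<sigma> n \<in> carrier ?T"
    by (auto simp: \<sigma>_def term_alg_def)
  then have "\<forall>n. \<theta> `` {\<sigma> n} \<in> carrier ?Q"
    by (auto simp: carrier_quotient_alg)
  then have "interp ?Q (\<lambda>n. \<theta> `` {\<sigma> n}) s = interp ?Q (\<lambda>n. \<theta> `` {\<sigma> n}) t"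
    using var st(3) by (auto simp: variety_def satisfies_def)
  then have "\<theta> `` {interp ?T \<sigma> s} = \<theta> `` {interp ?T \<sigma> t}"
    using interp_hom[OF hom algebra_term_alg \<sigma>] by simp
  moreover have "interp ?T \<sigma> r = r" if "vars r \<subseteq> {..<m}" for r
  proof -
    have "interp ?T \<sigma> r = interp ?T Var r"
      by (rule interp_cong_vars) (use that in \<open>auto simp: \<sigma>_def\<close>)
    then show ?thesis
      by (simp add: interp_term_alg_Var)
  qed
  ultimately have "\<theta> `` {s} = \<theta> `` {t}"
    using st by simp
  then show "(s, t) \<in> \<theta>"
    using congruence_class_eq_iff[OF cong, of s t] st by (simp add: term_alg_def)
qed

text \<open>The intersection is attained: the equational congruence belongs to the intersected
  family and lies below each of its members.\<close>

theorem free_congruence_eq: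
  assumes "\<forall>A\<in>K. algebra A"
  shows "free_congruence m K = equational_congruence m K"
  unfolding free_congruence_def
  using congruence_equational quotient_equational_in_variety[OF assms]
    equational_congruence_subset by (blast intro!: equalityI)


section \<open>Identities of Cartesian spaces\<close>

definition seqs :: "'u set \<Rightarrow> ('i \<Rightarrow> 'u) set" where
  "seqs U = {f. range f \<subseteq> U}"

lemma gs_unit_seqs: "U \<noteq> {} \<Longrightarrow> gs_unit (seqs U)"
  unfolding gs_unit_def seqs_def by (rule exI[of _ "{U}"]) (auto simp: disjoint_def)

lemma fun_upd_in_seqs_iff: "f \<in> seqs U \<Longrightarrow> f(i := u) \<in> seqs U \<longleftrightarrow> u \<in> U"
  by (auto simp: seqs_def)

text \<open>By \<open>closed\<close>, \<open>W\<close> is a zero-dimensional element of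
  \<open>full_alg V\<close>, and relativizing to such an element is a homomorphism. Cylindrification
  is the critical operation: its witnesses must not leave \<open>W\<close>.\<close>

lemma interp_relativize:
  assumes "W \<subseteq> V" and closed: "\<And>f i u. f \<in> W \<Longrightarrow> f(i := u) \<in> V \<Longrightarrow> f(i := u) \<in> W"
    and \<rho>: "\<forall>n. \<rho> n \<subseteq> V"
  shows "interp (full_alg W) (\<lambda>n. \<rho> n \<inter> W) t = interp (full_alg V) \<rho> t \<inter> W"
proof (induction t)
  case (Cyl i t)
  have sub: "interp (full_alg V) \<rho> t \<subseteq> V"
    by (rule interp_full_alg_subset[OF \<rho>])
  have "f(i := u) \<in> W" if "f \<in> W" "f(i := u) \<in> interp (full_alg V) \<rho> t" for f u
    using that closed sub by blast
  then show ?case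
    using Cyl assms(1) by (auto simp: full_alg_sel equiv_at_def)
qed (use assms(1) in \<open>auto simp: full_alg_sel\<close>)

text \<open>A unit is a disjoint union of Cartesian spaces, and a term can be evaluated in the one
  space containing the given sequence.\<close>

lemma identities_Gs_seqs_iff:
  assumes "infinite (UNIV :: 'i set)"
  shows "(s, t) \<in> identities (Gs :: ('i, ('i \<Rightarrow> 'u) set) cta set) \<longleftrightarrow>
    (\<forall>(U :: 'u set) \<rho>. \<forall>f\<in>seqs U. (\<forall>n. \<rho> n \<subseteq> seqs U) \<longrightarrow>
       f \<in> interp (full_alg (seqs U)) \<rho> s \<longleftrightarrow> f \<in> interp (full_alg (seqs U)) \<rho> t)"
    (is "_ \<longleftrightarrow> ?R")
proof
  assume L: "(s, t) \<in> identities (Gs :: ('i, ('i \<Rightarrow> 'u) set) cta set)"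
  show ?R
  proof (intro allI ballI impI)
    fix U :: "'u set" and \<rho> :: "nat \<Rightarrow> ('i \<Rightarrow> 'u) set" and f :: "'i \<Rightarrow> 'u"
    assume "f \<in> seqs U" and \<rho>: "\<forall>n. \<rho> n \<subseteq> seqs U"
    then have "gs_unit (seqs U :: ('i \<Rightarrow> 'u) set)"
      by (intro gs_unit_seqs) (auto simp: seqs_def)
    then show "f \<in> interp (full_alg (seqs U)) \<rho> s \<longleftrightarrow> f \<in> interp (full_alg (seqs U)) \<rho> t"
      using L \<rho> by (simp add: identities_Gs_iff satisfies_def full_alg_sel)
  qed
next
  assume R: ?R
  \<comment> \<open>Stated for arbitrary \<open>s\<close> and \<open>t\<close>, so that exchanging
    them gives the reverse inclusion.\<close>
  have sub: "interp (full_alg V) \<rho> s \<subseteq> interp (full_alg V) \<rho> t"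
    if st: "\<forall>(U :: 'u set) \<rho>. \<forall>f\<in>seqs U. (\<forall>n. \<rho> n \<subseteq> seqs U) \<longrightarrow>
       f \<in> interp (full_alg (seqs U)) \<rho> s \<longleftrightarrow> f \<in> interp (full_alg (seqs U)) \<rho> t"
      and V: "gs_unit V" and \<rho>: "\<forall>n. \<rho> n \<subseteq> V" for V :: "('i \<Rightarrow> 'u) set" and \<rho> s t
  proof
    fix f assume f: "f \<in> interp (full_alg V) \<rho> s"
    obtain \<U> where disj: "disjoint \<U>" and VU: "V = (\<Union>U\<in>\<U>. seqs U)"
      using V by (auto simp: gs_unit_def seqs_def)
    have "f \<in> V"
      using f interp_full_alg_subset[OF \<rho>] by blast
    then obtain U where U: "U \<in> \<U>" and fU: "f \<in> seqs U"
      using VU by auto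
    \<comment> \<open>With more than one index, some coordinate \<open>j\<close> survives the change
      at \<open>i\<close>; by disjointness its value determines the block.\<close>
    have closed: "g(i := u) \<in> seqs U" if g: "g \<in> seqs U" and h: "g(i := u) \<in> V" for g i u
    proof -
      obtain U' where U': "U' \<in> \<U>" "g(i := u) \<in> seqs U'"
        using h VU by auto
      obtain j where "j \<noteq> i"
        using assms by (metis ex_new_if_finite finite.emptyI finite_insert singletonI)
      then have "g j \<in> U \<inter> U'"
        using g U' unfolding seqs_def mem_Collect_eq by (metis IntI fun_upd_other rangeI subsetD)
      then have "U = U'"
        using disj U U' by (auto simp: disjoint_def)
      then show ?thesis
        using U' by simp
    qed
    have sV: "seqs U \<subseteq> V"
      using U VU by auto
    note rel = interp_relativize[OF sV closed \<rho>]
    have "f \<in> interp (full_alg (seqs U)) (\<lambda>n. \<rho> n \<inter> seqs U) s"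
      using f fU rel by blast
    then have "f \<in> interp (full_alg (seqs U)) (\<lambda>n. \<rho> n \<inter> seqs U) t"
      using st fU by auto
    then show "f \<in> interp (full_alg V) \<rho> t"
      using rel by blast
  qed
  have R': "\<forall>(U :: 'u set) \<rho>. \<forall>f\<in>seqs U. (\<forall>n. \<rho> n \<subseteq> seqs U) \<longrightarrow>
       f \<in> interp (full_alg (seqs U)) \<rho> t \<longleftrightarrow> f \<in> interp (full_alg (seqs U)) \<rho> s"
    using R by blast
  show "(s, t) \<in> identities (Gs :: ('i, ('i \<Rightarrow> 'u) set) cta set)"
    unfolding identities_Gs_iff satisfies_def full_alg_sel
    by (auto dest: sub[OF R, THEN subsetD] sub[OF R', THEN subsetD])
qed

section \<open>Evaluation of terms in a Cartesian space\<close>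

lemma interp_seqs_cyl:
  assumes "f \<in> seqs U" and "\<forall>n. \<rho> n \<subseteq> seqs U"
  shows "f \<in> interp (full_alg (seqs U)) \<rho> (Cyl i t) \<longleftrightarrow>
    (\<exists>u\<in>U. f(i := u) \<in> interp (full_alg (seqs U)) \<rho> t)"
  using assms(1) interp_full_alg_subset[OF assms(2), of t] fun_upd_in_seqs_iff[OF assms(1)]
  by (auto simp: full_alg_sel equiv_at_def)

text \<open>The new valuation is the preimage of \<open>\<rho>\<close> under the map taking
  \<open>h\<close> on \<open>\<Gamma>\<close> and \<open>f\<close> elsewhere. This map commutes with
  changes at indices in \<open>\<Gamma>\<close> and respects diagonals there. It makes the value of
  \<open>t\<close> at \<open>h\<close> depend only on \<open>h\<close> restricted to
  \<open>\<Gamma>\<close>.\<close>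

lemma interp_override_on:
  fixes f :: "'i \<Rightarrow> 'u"
  assumes f: "f \<in> seqs U" and \<rho>: "\<forall>n. \<rho> n \<subseteq> seqs U" and "inds t \<subseteq> \<Gamma>" and "h \<in> seqs U"
  shows "h \<in> interp (full_alg (seqs U)) (\<lambda>n. {h \<in> seqs U. override_on f h \<Gamma> \<in> \<rho> n}) t \<longleftrightarrow>
    override_on f h \<Gamma> \<in> interp (full_alg (seqs U)) \<rho> t"
  using assms(3,4)
proof (induction t arbitrary: h)
  case (Cyl i t)
  have in_seqs: "override_on f h \<Gamma> \<in> seqs U" if "h \<in> seqs U" for h
    using f that by (auto simp: override_on_def seqs_def)
  have "override_on f (h(i := u)) \<Gamma> = (override_on f h \<Gamma>)(i := u)" for u
    using Cyl.prems(1) by (auto simp: override_on_def)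
  moreover have "h(i := u) \<in> seqs U" if "u \<in> U" for u
    using Cyl.prems(2) that by (simp add: fun_upd_in_seqs_iff)
  moreover have "\<forall>n. {h \<in> seqs U. override_on f h \<Gamma> \<in> \<rho> n} \<subseteq> seqs U"
    by blast
  ultimately show ?case
    using Cyl by (simp add: interp_seqs_cyl in_seqs \<rho> del: interp.simps)
next
  case (Diag i j)
  then show ?case
    using f by (auto simp: full_alg_sel seqs_def override_on_def)
qed (use f in \<open>auto simp: full_alg_sel seqs_def override_on_def\<close>)

text \<open>Over a singleton base there is just one sequence, so cylindrifications are identities,
  diagonals are everything, and evaluation is propositional in the truth values of the
  generators.\<close>

lemma interp_singleton_base:
  assumes "f \<in> seqs {u}" "g \<in> seqs {v}" and "\<forall>n. \<rho> n \<subseteq> seqs {u}" "\<forall>n. \<sigma> n \<subseteq> seqs {v}"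
    and "\<forall>n\<in>vars t. f \<in> \<rho> n \<longleftrightarrow> g \<in> \<sigma> n"
  shows "f \<in> interp (full_alg (seqs {u})) \<rho> t \<longleftrightarrow> g \<in> interp (full_alg (seqs {v})) \<sigma> t"
  using assms(5)
proof (induction t)
  case (Cyl i t)
  have "f(i := u) = f" "g(i := v) = g"
    using assms(1,2) by (auto simp: seqs_def fun_eq_iff image_subset_iff)
  then show ?case
    using Cyl by (simp add: interp_seqs_cyl assms del: interp.simps)
next
  case (Diag i j)
  have "f i = f j" "g i = g j"
    using assms(1,2) by (simp_all add: seqs_def image_subset_iff)
  then show ?case
    using assms(1,2) by (simp add: full_alg_sel)
qed (use assms(1,2) in \<open>auto simp: full_alg_sel\<close>)


section \<open>Atoms\<close>

definition singleton_base :: "'i \<Rightarrow> 'i \<Rightarrow> 'i trm" where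
  "singleton_base i j = Compl (Cyl i (Cyl j (Compl (Diag i j))))"

text \<open>As \<open>i \<noteq> j\<close>, the two cylindrifications reach every pair of values at
  \<open>i\<close> and \<open>j\<close>, so the complement denies two distinct base elements;
  \<open>f i\<close> witnesses that there is at least one.\<close>

lemma interp_singleton_base_iff:
  assumes "i \<noteq> j" and f: "f \<in> seqs U" and \<rho>: "\<forall>n. \<rho> n \<subseteq> seqs U"
  shows "f \<in> interp (full_alg (seqs U)) \<rho> (singleton_base i j) \<longleftrightarrow> (\<exists>u. U = {u})"
proof -
  let ?I = "interp (full_alg (seqs U)) \<rho>"
  have mem: "f(i := u, j := v) \<in> seqs U" "f(i := u) \<in> seqs U" if "u \<in> U" "v \<in> U" for u v
    using f that by (auto simp: seqs_def)
  have "f \<in> ?I (Cyl i (Cyl j (Compl (Diag i j)))) \<longleftrightarrow>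
      (\<exists>u\<in>U. f(i := u) \<in> ?I (Cyl j (Compl (Diag i j))))"
    by (rule interp_seqs_cyl[OF f \<rho>])
  also have "\<dots> \<longleftrightarrow> (\<exists>u\<in>U. \<exists>v\<in>U. f(i := u, j := v) \<in> ?I (Compl (Diag i j)))"
    using interp_seqs_cyl[OF mem(2) \<rho>] by blast
  also have "\<dots> \<longleftrightarrow> (\<exists>u\<in>U. \<exists>v\<in>U. u \<noteq> v)"
    using mem assms(1) by (auto simp: full_alg_sel)
  finally have "f \<in> ?I (singleton_base i j) \<longleftrightarrow> \<not> (\<exists>u\<in>U. \<exists>v\<in>U. u \<noteq> v)"
    using f by (simp add: singleton_base_def full_alg_sel del: interp.simps(7))
  moreover have "f i \<in> U"
    using f by (auto simp: seqs_def)
  ultimately show ?thesis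
    by blast
qed

text \<open>The minterm over the generators selected by \<open>S\<close>, joined to the condition
  \<delta> at the end of the fold.\<close>

definition atom_term :: "'i \<Rightarrow> 'i \<Rightarrow> nat \<Rightarrow> nat set \<Rightarrow> 'i trm" where
  "atom_term i j m S = foldr (\<lambda>n. Meet (if n \<in> S then Var n else Compl (Var n))) [0..<m]
     (singleton_base i j)"

lemma vars_atom_term: "vars (atom_term i j m S) \<subseteq> {..<m}"
proof -
  have "vars (foldr (\<lambda>n. Meet (if n \<in> S then Var n else Compl (Var n))) ns t) = set ns \<union> vars t"
    for ns and t :: "'a trm"
    by (induction ns) auto
  then show ?thesis
    by (auto simp: atom_term_def singleton_base_def)
qed

lemma interp_atom_term_iff:
  assumes "i \<noteq> j" and f: "f \<in> seqs U" and \<rho>: "\<forall>n. \<rho> n \<subseteq> seqs U"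
  shows "f \<in> interp (full_alg (seqs U)) \<rho> (atom_term i j m S) \<longleftrightarrow>
    (\<exists>u. U = {u}) \<and> (\<forall>n<m. f \<in> \<rho> n \<longleftrightarrow> n \<in> S)"
proof -
  have "f \<in> interp (full_alg (seqs U)) \<rho>
        (foldr (\<lambda>n. Meet (if n \<in> S then Var n else Compl (Var n))) ns t) \<longleftrightarrow>
      f \<in> interp (full_alg (seqs U)) \<rho> t \<and> (\<forall>n\<in>set ns. f \<in> \<rho> n \<longleftrightarrow> n \<in> S)" for ns t
    using f by (induction ns) (auto simp: full_alg_sel)
  then show ?thesis
    using interp_singleton_base_iff[OF assms] by (auto simp: atom_term_def)
qed

text \<open>The well-ordered index type represents the ordinal \<alpha>. By
  \<open>identities_Gs_base_type\<close>, every infinite type of base elements yields the same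
  variety.\<close>

theorem theorem1p1:
  fixes m :: nat
  assumes "infinite (UNIV :: 'i::wellorder set)"
    and "infinite (UNIV :: 'u set)"
    and "F = free_alg m (Gs :: ('i, ('i \<Rightarrow> 'u) set) cta set)"
  shows "card (atoms F) = 2 ^ m \<and> (\<forall>a\<in>atoms F. zero_dimensional F a)"
proof -

  \<comment> \<open>Elements of the free algebra as classes of terms\<close>
  let ?K = "Gs :: ('i, ('i \<Rightarrow> 'u) set) cta set"
  let ?T = "term_alg m :: ('i, 'i trm) cta"
  define \<theta> where "\<theta> = equational_congruence m ?K"
  define cls where "cls = (\<lambda>t. \<theta> `` {t})"
  let ?T' = "carrier ?T"
  have cong: "congruence ?T \<theta>"
    unfolding \<theta>_def by (rule congruence_equational)
  have "\<forall>A\<in>?K. algebra A"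
    by (simp add: Gs_def)
  then have F: "F = quotient_alg ?T \<theta>"
    unfolding assms(3) free_alg_def \<theta>_def by (simp add: free_congruence_eq)
  have carF: "carrier F = cls ` ?T'"
    by (simp add: F carrier_quotient_alg cls_def)
  have hom: "cls \<in> hom ?T F"
    unfolding F cls_def by (rule quotient_map_hom[OF cong])
  have ops: "join F (cls s) (cls t) = cls (Join s t)" "cyl F i (cls s) = cls (Cyl i s)"
    if "s \<in> ?T'" "t \<in> ?T'" for s t i
    using hom that by (auto simp: hom_def term_alg_def)
  have bot: "bottom F = cls Bottom"
    using hom by (auto simp: hom_def term_alg_def)
  have eq: "cls s = cls t \<longleftrightarrow> (s, t) \<in> identities ?K" if "s \<in> ?T'" "t \<in> ?T'" for s t
    using congruence_class_eq_iff[OF cong that] that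
    by (simp add: cls_def \<theta>_def equational_congruence_def term_alg_def)
  note idt = identities_Gs_seqs_iff[OF assms(1), where 'u = 'u]
  have T': "Bottom \<in> ?T'" "\<And>s t. Join s t \<in> ?T' \<longleftrightarrow> s \<in> ?T' \<and> t \<in> ?T'"
    "\<And>s t. Meet s t \<in> ?T' \<longleftrightarrow> s \<in> ?T' \<and> t \<in> ?T'"
    "\<And>i t. Cyl i t \<in> ?T' \<longleftrightarrow> t \<in> ?T'" "\<And>i j. Diag i j \<in> ?T'"
    by (auto simp: term_alg_def)
  \<comment> \<open>Semantic reading of the Boolean structure: non-zero means satisfiable at some
    sequence, and the order proved next is implication at every sequence.\<close>
  have nz: "cls t \<noteq> bottom F \<longleftrightarrow> (\<exists>(U :: 'u set) \<rho>. \<exists>f\<in>seqs U. (\<forall>n. \<rho> n \<subseteq> seqs U) \<and>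
      f \<in> interp (full_alg (seqs U)) \<rho> t)" if "t \<in> ?T'" for t
    unfolding bot eq[OF that T'(1)] idt by (auto simp: full_alg_sel)
  have le_iff: "le F (cls s) (cls t) \<longleftrightarrow>
    (\<forall>(U :: 'u set) \<rho>. \<forall>f\<in>seqs U. (\<forall>n. \<rho> n \<subseteq> seqs U) \<longrightarrow>
       f \<in> interp (full_alg (seqs U)) \<rho> s \<longrightarrow> f \<in> interp (full_alg (seqs U)) \<rho> t)"
    if "s \<in> ?T'" "t \<in> ?T'" for s t
    unfolding le_def ops(1)[OF that] using that
    by (subst eq) (auto simp: T' idt full_alg_sel)
  obtain i0 j0 :: 'i where ij: "i0 \<noteq> j0"
    using assms(1) by (metis ex_new_if_finite finite.emptyI finite_insert singletonI)
  define a where "a = (\<lambda>S. atom_term i0 j0 m S)"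
  have aT: "a S \<in> ?T'" for S
    using vars_atom_term[of i0 j0 m S] by (simp add: a_def term_alg_def)
  note a_iff = interp_atom_term_iff[OF ij, where m = m, folded a_def]

  \<comment> \<open>The minterms over a singleton base are atoms\<close>
  have a_nz: "\<exists>(U :: 'u set) \<rho>. \<exists>f\<in>seqs U. (\<forall>n. \<rho> n \<subseteq> seqs U) \<and>
      f \<in> interp (full_alg (seqs U)) \<rho> (a S)" for S
  proof -
    \<comment> \<open>Any base element will do. The constant sequence is the whole space over
      \<open>{u}\<close>, and \<open>\<rho>\<close> makes the generators in \<open>S\<close>
      everything and the others empty.\<close>
    define u :: 'u where "u = undefined"
    define \<rho> :: "nat \<Rightarrow> ('i \<Rightarrow> 'u) set" where "\<rho> = (\<lambda>n. if n \<in> S then {\<lambda>_. u} else {})"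
    have "(\<lambda>_. u) \<in> (seqs {u} :: ('i \<Rightarrow> 'u) set)" and "\<forall>n. \<rho> n \<subseteq> seqs {u}"
      by (auto simp: seqs_def \<rho>_def)
    moreover from this have "(\<lambda>_. u) \<in> interp (full_alg (seqs {u})) \<rho> (a S)"
      by (subst a_iff) (auto simp: \<rho>_def)
    ultimately show ?thesis
      by blast
  qed

  have a_atom: "cls (a S) \<in> atoms F" for S
  proof -
    \<comment> \<open>A sequence satisfying \<open>t\<close> satisfies \<open>a S\<close>, so its
      base is a singleton and its generators have pattern \<open>S\<close>. By
      \<open>interp_singleton_base\<close>, \<open>t\<close> then holds wherever this pattern occurs
      over a singleton base, that is, wherever \<open>a S\<close> holds.\<close>
    have "cls t = cls (a S)" if t: "t \<in> ?T'" and "cls t \<noteq> bottom F" and "le F (cls t) (cls (a S))" for t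
    proof -
      obtain U :: "'u set" and \<rho> f where f: "f \<in> seqs U" "\<forall>n. \<rho> n \<subseteq> seqs U"
        and ft: "f \<in> interp (full_alg (seqs U)) \<rho> t"
        using \<open>cls t \<noteq> bottom F\<close> nz[OF t] by auto
      have le: "f \<in> interp (full_alg (seqs U)) \<rho> (a S)"
        if "f \<in> seqs U" "\<forall>n. \<rho> n \<subseteq> seqs U" "f \<in> interp (full_alg (seqs U)) \<rho> t"
        for U :: "'u set" and \<rho> f
        using \<open>le F (cls t) (cls (a S))\<close> le_iff[OF t aT] that by blast
      obtain u where u: "U = {u}" and fS: "\<forall>n<m. f \<in> \<rho> n \<longleftrightarrow> n \<in> S"
        using le[OF f ft] a_iff[OF f] by blast
      have "g \<in> interp (full_alg (seqs W)) \<sigma> t"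
        if g: "g \<in> seqs W" "\<forall>n. \<sigma> n \<subseteq> seqs W" and ga: "g \<in> interp (full_alg (seqs W)) \<sigma> (a S)"
        for W :: "'u set" and \<sigma> g
      proof -
        obtain w where w: "W = {w}" and gS: "\<forall>n<m. g \<in> \<sigma> n \<longleftrightarrow> n \<in> S"
          using ga a_iff[OF g] by blast
        have "\<forall>n\<in>vars t. f \<in> \<rho> n \<longleftrightarrow> g \<in> \<sigma> n"
          using fS gS t by (auto simp: term_alg_def)
        then show ?thesis
          using interp_singleton_base[of f u g w \<rho> \<sigma> t] f g ft unfolding u w by simp
      qed
      then show ?thesis
        unfolding eq[OF t aT] idt using le by blast
    qed
    then show ?thesis
      using nz[OF aT] a_nz aT by (auto simp: atoms_def carF)
  qed

  \<comment> \<open>A sequence satisfying both terms shows that its pattern of generators is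
    \<open>S\<close> as well as \<open>S'\<close>.\<close>
  have a_inj: "S = S'" if "cls (a S) = cls (a S')" and S: "S \<subseteq> {..<m}" "S' \<subseteq> {..<m}" for S S'
  proof -
    obtain U :: "'u set" and \<rho> f where f: "f \<in> seqs U" "\<forall>n. \<rho> n \<subseteq> seqs U"
      and "f \<in> interp (full_alg (seqs U)) \<rho> (a S)"
      using a_nz by blast
    moreover from this have "f \<in> interp (full_alg (seqs U)) \<rho> (a S')"
      using that(1) unfolding eq[OF aT aT] idt by blast
    ultimately have "\<forall>n<m. n \<in> S \<longleftrightarrow> n \<in> S'"
      using a_iff[OF f, of S] a_iff[OF f, of S'] by simp
    then show ?thesis
      using S by auto
  qed

  \<comment> \<open>Every atom is one of these minterms\<close>
  have a_all: "x \<in> (\<lambda>S. cls (a S)) ` Pow {..<m}" if x: "x \<in> atoms F" for x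
  proof -
    obtain t where t: "t \<in> ?T'" and xt: "x = cls t"
      using x by (auto simp: atoms_def carF)
    have below: "cls s = x" if "s \<in> ?T'" "cls s \<noteq> bottom F" "le F (cls s) x" for s
      using x that by (auto simp: atoms_def carF)
    obtain U :: "'u set" and \<rho> f where f: "f \<in> seqs U" "\<forall>n. \<rho> n \<subseteq> seqs U"
      and ft: "f \<in> interp (full_alg (seqs U)) \<rho> t"
      using x xt nz[OF t] by (auto simp: atoms_def)
    have "\<exists>u. U = {u}"
    proof (rule ccontr)
      assume nsing: "\<nexists>u. U = {u}"
      \<comment> \<open>If the base is no singleton, the atom is split by a diagonal at fresh
        indices \<open>i\<close> and \<open>j\<close>: equality with \<open>f i\<close> at
        \<open>j\<close> can be made true or false without disturbing \<open>t\<close>.\<close>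
      obtain i where i: "i \<notin> inds t"
        using assms(1) finite_inds ex_new_if_finite by blast
      obtain j where j: "j \<notin> insert i (inds t)"
        using assms(1) finite_inds[of t] ex_new_if_finite finite_insert by metis
      have "f i \<in> U"
        using f by (auto simp: seqs_def)
      then obtain v where v: "v \<in> U" "v \<noteq> f i"
        using nsing by blast
      \<comment> \<open>Under this valuation \<open>t\<close> ignores coordinates outside
        \<open>inds t\<close>, so it holds at \<open>f(j := w)\<close> for every \<open>w\<close> in
        the base.\<close>
      define \<sigma> where "\<sigma> = (\<lambda>n. {h \<in> seqs U. override_on f h (inds t) \<in> \<rho> n})"
      have \<sigma>: "\<forall>n. \<sigma> n \<subseteq> seqs U"
        by (auto simp: \<sigma>_def)
      have mem: "f(j := w) \<in> seqs U" "f(j := w) \<in> interp (full_alg (seqs U)) \<sigma> t" if "w \<in> U" for w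
      proof -
        show *: "f(j := w) \<in> seqs U"
          using f that by (simp add: fun_upd_in_seqs_iff)
        have "override_on f (f(j := w)) (inds t) = f"
          using j by (auto simp: override_on_def)
        then show "f(j := w) \<in> interp (full_alg (seqs U)) \<sigma> t"
          unfolding \<sigma>_def using interp_override_on[OF f subset_refl *] ft by simp
      qed
      let ?s = "Meet t (Diag i j)"
      have s: "?s \<in> ?T'"
        using t T' by simp
      have "f(j := f i) \<in> interp (full_alg (seqs U)) \<sigma> ?s"
        using mem[OF \<open>f i \<in> U\<close>] j by (simp add: full_alg_sel)
      then have "cls ?s \<noteq> bottom F"
        unfolding nz[OF s] using mem[OF \<open>f i \<in> U\<close>] \<sigma> by blast
      moreover have "le F (cls ?s) x"
        unfolding xt le_iff[OF s t] by (simp add: full_alg_sel)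
      ultimately have "cls ?s = cls t"
        using below s xt by simp
      \<comment> \<open>The non-zero part of \<open>x\<close> on the diagonal must be all of
        \<open>x\<close>, but \<open>f(j := v)\<close> satisfies \<open>t\<close> and lies off the
        diagonal.\<close>
      then have "f(j := v) \<in> interp (full_alg (seqs U)) \<sigma> ?s"
        using mem[OF v(1)] \<sigma> unfolding eq[OF s t] idt by blast
      then show False
        using v(2) j by (auto simp: full_alg_sel)
    qed
    \<comment> \<open>The pattern of the generators at \<open>f\<close>. Then \<open>x\<close> and
      \<open>cls (a S)\<close> are atoms with a non-zero common lower bound, hence equal.\<close>
    define S where "S = {n. n < m \<and> f \<in> \<rho> n}"
    let ?s = "Meet t (a S)"
    have s: "?s \<in> ?T'"
      using t aT T' by simp
    have "f \<in> interp (full_alg (seqs U)) \<rho> ?s"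
      using ft a_iff[OF f] \<open>\<exists>u. U = {u}\<close> by (auto simp: full_alg_sel S_def)
    then have "cls ?s \<noteq> bottom F"
      unfolding nz[OF s] using f by blast
    moreover have "le F (cls ?s) x" "le F (cls ?s) (cls (a S))"
      unfolding xt le_iff[OF s t] le_iff[OF s aT] by (simp_all add: full_alg_sel)
    ultimately have "cls ?s = x" "cls ?s = cls (a S)"
      using below s a_atom[of S] by (auto simp: atoms_def carF)
    then show ?thesis
      by (auto simp: S_def)
  qed

  \<comment> \<open>Number and zero-dimensionality of the atoms\<close>
  have atoms: "atoms F = (\<lambda>S. cls (a S)) ` Pow {..<m}"
    using a_atom a_all by blast
  have "inj_on (\<lambda>S. cls (a S)) (Pow {..<m})"
    using a_inj by (auto simp: inj_on_def)
  then have "card (atoms F) = 2 ^ m"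
    by (simp add: atoms card_image card_Pow)
  \<comment> \<open>Over a singleton base, changing a coordinate leaves the sequence fixed; over any
    other base \<open>a S\<close> holds nowhere, and neither does its cylindrification.\<close>
  moreover have "cyl F i (cls (a S)) = cls (a S)" for i S
  proof -
    have "f \<in> interp (full_alg (seqs U)) \<rho> (Cyl i (a S)) \<longleftrightarrow> f \<in> interp (full_alg (seqs U)) \<rho> (a S)"
      if f: "f \<in> seqs U" "\<forall>n. \<rho> n \<subseteq> seqs U" for U :: "'u set" and \<rho> f
    proof (cases "\<exists>u. U = {u}")
      case True
      then obtain u where "U = {u}" by blast
      moreover from this have "f(i := u) = f"
        using f(1) by (auto simp: seqs_def fun_eq_iff image_subset_iff)
      ultimately show ?thesis
        unfolding interp_seqs_cyl[OF f] by simp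
    next
      case False
      then have "\<not> (\<exists>u. U = {u} \<and> P)" for P
        by blast
      then show ?thesis
        using False f by (simp add: interp_seqs_cyl[OF f] a_iff fun_upd_in_seqs_iff del: interp.simps)
    qed
    moreover have "Cyl i (a S) \<in> ?T'"
      using aT T' by simp
    ultimately show ?thesis
      using eq[OF \<open>Cyl i (a S) \<in> ?T'\<close> aT] idt ops(2)[OF aT aT] by simp
  qed
  ultimately show ?thesis
    by (auto simp: atoms zero_dimensional_def)
qed

end
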